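(* Let $\Phi=(A;\{E_i\}_{i=0}^d;A^*;\{E_i^*\}_{i=0}^d)$ be a tridiagonal system of diameter $d\geq 1$ on $V$ over $\mathbb{K}$, with base $\beta$ and eigenvalue sequence $\{\theta_i\}_{i=0}^d$, and set $\vartheta_i=\sum_{h=0}^{i-1}\frac{\theta_h-\theta_{d-h}}{\theta_0-\theta_d}$ for $0\le i\le d+1$. Assume that one of the following holds: (i) $\beta\ne\pm2$; (ii) $\beta=2$ and $\mathrm{Char}(\mathbb{K})\ne2$; (iv) $\beta=-2$, $\mathrm{Char}(\mathbb{K})\ne2$ and $d$ is even. Then $\vartheta_i\ne0$ for $1\le i\le d$.
   Context: $\mathbb{K}$ is a field, $V$ is a $\mathbb{K}$-vector space of finite positive dimension, $\mathrm{End}(V)$ is the algebra of linear maps $V\to V$. A tridiagonal pair (TD pair) on $V$ is an ordered pair $A,A^*\in\mathrm{End}(V)$ ($A^*$ is just a name, not an adjoint) such that: (i) $A$ and $A^*$ are each diagonalizable over $\mathbb{K}$; (ii) there is an ordering $\{V_i\}_{i=0}^d$ of the eigenspaces of $A$ with $A^*V_i\subseteq V_{i-1}+V_i+V_{i+1}$ for $0\le i\le d$, where $V_{-1}=V_{d+1}=0$; (iii) there is an ordering $\{V_i^*\}_{i=0}^{\delta}$ of the eigenspaces of $A^*$ with $AV_i^*\subseteq V_{i-1}^*+V_i^*+V_{i+1}^*$ for $0\le i\le\delta$, where $V_{-1}^*=V_{\delta+1}^*=0$; (iv) there is no subspace $W$ of $V$ with $AW\subseteq W$, $A^*W\subseteq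 W$, $W\ne0$, $W\ne V$. It is known that $d=\delta$; this is the diameter, and it is assumed that $d\ge1$. Orderings satisfying (ii) (resp. (iii)) are called standard. The primitive idempotent of a diagonalizable map associated with one of its eigenspaces is the projection of $V$ onto that eigenspace that kills the other eigenspaces. A tridiagonal system (TD system) on $V$ is a sequence $\Phi=(A;\{E_i\}_{i=0}^d;A^*;\{E_i^*\}_{i=0}^d)$ where $A,A^*$ is a TD pair on $V$, $\{E_i\}_{i=0}^d$ is an ordering of the primitive idempotents of $A$ such that $\{E_iV\}_{i=0}^d$ is standard, and $\{E_i^*\}_{i=0}^d$ is an ordering of the primitive idempotents of $A^*$ such that $\{E_i^*V\}_{i=0}^d$ is standard. Let $\theta_i$ (resp. $\theta_i^*$) be the eigenvalue of $A$ on $E_iV$ (resp. of $A^*$ on $E_i^*V$); $\{\theta_i\}_{i=0}^d$ is the eigenvalue sequence of $\Phi$. Base: it is known that the expressions $\frac{\theta_{i-2}-\theta_{i+1}}{\theta_{i-1}-\theta_i}$ and $\frac{\theta^*_{i-2}-\theta^*_{i+1}}{\theta^*_{i-1}-\theta^*_i}$ are equal and independent of $i$ for $2\le i\le d-1$. If $d\ge3$, the base $\beta\in\mathbb{K}$ is defined by letting $\beta+1$ be this common value; if $d\le2$, $\beta$ is any nonzero scalar in $\mathbb{K}$. *)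

theory Defs
  imports "HOL-Computational_Algebra.Computational_Algebra"
begin

text \<open>The integer index realises the convention that the terms of index \<open>-1\<close> and \<open>d + 1\<close>
  are the zero subspace.\<close>

definition extend_zero :: "nat \<Rightarrow> (nat \<Rightarrow> 'b::zero set) \<Rightarrow> int \<Rightarrow> 'b::zero set" where
  "extend_zero d U i = (if 0 \<le> i \<and> i \<le> int d then U (nat i) else {0})"

locale td_space = finite_dimensional_vector_space +
  assumes dim_UNIV_pos: "dim UNIV > 0"
begin

definition eigenspace :: "('b \<Rightarrow> 'b) \<Rightarrow> 'a \<Rightarrow> 'b set" where
  "eigenspace A t = {v. A v = scale t v}"

definition eigenspaces :: "('b \<Rightarrow> 'b) \<Rightarrow> 'b set set" where
  "eigenspaces A = {eigenspace A t | t. eigenspace A t \<noteq> {0}}"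

definition diagonalizable :: "('b \<Rightarrow> 'b) \<Rightarrow> bool" where
  "diagonalizable A \<longleftrightarrow> span (\<Union> (eigenspaces A)) = UNIV"

text \<open>\<open>U 0, \<dots>, U d\<close> lists every eigenspace of \<open>A\<close> exactly once, and \<open>As\<close> acts on this
  list in a block tridiagonal way. Values of \<open>U\<close> beyond \<open>d\<close> are irrelevant.\<close>

definition standard_ordering ::
    "('b \<Rightarrow> 'b) \<Rightarrow> ('b \<Rightarrow> 'b) \<Rightarrow> nat \<Rightarrow> (nat \<Rightarrow> 'b set) \<Rightarrow> bool" where
  "standard_ordering A As d U \<longleftrightarrow>
     bij_betw U {0..d} (eigenspaces A) \<and>
     (\<forall>i\<in>{0..d}. As ` U i \<subseteq>
        {x + y + z | x y z. x \<in> extend_zero d U (int i - 1) \<and> y \<in> U i \<and>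
                            z \<in> extend_zero d U (int i + 1)})"

definition td_pair :: "('b \<Rightarrow> 'b) \<Rightarrow> ('b \<Rightarrow> 'b) \<Rightarrow> bool" where
  "td_pair A As \<longleftrightarrow>
     Vector_Spaces.linear scale scale A \<and> Vector_Spaces.linear scale scale As \<and>
     diagonalizable A \<and> diagonalizable As \<and>
     (\<exists>d U. standard_ordering A As d U) \<and>
     (\<exists>\<delta> Us. standard_ordering As A \<delta> Us) \<and>
     \<not> (\<exists>W. subspace W \<and> A ` W \<subseteq> W \<and> As ` W \<subseteq> W \<and> W \<noteq> {0} \<and> W \<noteq> UNIV)"

definition primitive_idempotents :: "('b \<Rightarrow> 'b) \<Rightarrow> ('b \<Rightarrow> 'b) set" where
  "primitive_idempotents A =
     {E. Vector_Spaces.linear scale scale E \<and>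
         (\<exists>U\<in>eigenspaces A. range E = U \<and> (\<forall>v\<in>U. E v = v) \<and>
            (\<forall>U'\<in>eigenspaces A. U' \<noteq> U \<longrightarrow> (\<forall>v\<in>U'. E v = 0)))}"

definition td_system ::
    "nat \<Rightarrow> ('b \<Rightarrow> 'b) \<Rightarrow> (nat \<Rightarrow> 'b \<Rightarrow> 'b) \<Rightarrow> ('b \<Rightarrow> 'b) \<Rightarrow> (nat \<Rightarrow> 'b \<Rightarrow> 'b) \<Rightarrow> bool" where
  "td_system d A E As Es \<longleftrightarrow>
     td_pair A As \<and>
     bij_betw E {0..d} (primitive_idempotents A) \<and>
     standard_ordering A As d (\<lambda>i. range (E i)) \<and>
     bij_betw Es {0..d} (primitive_idempotents As) \<and>
     standard_ordering As A d (\<lambda>i. range (Es i))"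

text \<open>In a TD system every \<open>range (E i)\<close> is a nonzero eigenspace, so this determines
  \<open>\<theta> 0, \<dots>, \<theta> d\<close> uniquely.\<close>

definition eigenvalue_sequence ::
    "nat \<Rightarrow> ('b \<Rightarrow> 'b) \<Rightarrow> (nat \<Rightarrow> 'b \<Rightarrow> 'b) \<Rightarrow> (nat \<Rightarrow> 'a) \<Rightarrow> bool" where
  "eigenvalue_sequence d A E \<theta> \<longleftrightarrow> (\<forall>i\<in>{0..d}. \<forall>v\<in>range (E i). A v = scale (\<theta> i) v)"

end

text \<open>\<open>\<beta> + 1\<close> is the common value of all the quotients below. That such a common value exists
  for every TD system with \<open>d \<ge> 3\<close> is a known theorem. For \<open>d \<le> 2\<close> the base is not unique:
  every nonzero scalar is allowed.\<close>

definition is_base :: "nat \<Rightarrow> (nat \<Rightarrow> 'a::field) \<Rightarrow> (nat \<Rightarrow> 'a) \<Rightarrow> 'a \<Rightarrow> bool" where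
  "is_base d \<theta> \<theta>s \<beta> \<longleftrightarrow>
     (if d \<ge> 3 then
        (\<forall>i\<in>{2..d-1}. (\<theta> (i-2) - \<theta> (i+1)) / (\<theta> (i-1) - \<theta> i) = \<beta> + 1 \<and>
                      (\<theta>s (i-2) - \<theta>s (i+1)) / (\<theta>s (i-1) - \<theta>s i) = \<beta> + 1)
      else \<beta> \<noteq> 0)"

text \<open>Used only for \<open>i \<le> d + 1\<close>, so that \<open>h \<le> d\<close> and the subtraction \<open>d - h\<close> is exact.\<close>

definition vartheta :: "nat \<Rightarrow> (nat \<Rightarrow> 'a::field) \<Rightarrow> nat \<Rightarrow> 'a" where
  "vartheta d \<theta> i = (\<Sum>h<i. (\<theta> h - \<theta> (d - h)) / (\<theta> 0 - \<theta> d))"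

end

theory Submission
  imports Defs
begin

text \<open>
  Two facts about the eigenvalues suffice: \<open>\<theta> 0, \<dots>, \<theta> d\<close> are distinct, and
  \<open>\<theta> i - \<theta> (i+3) = (\<beta>+1) (\<theta> (i+1) - \<theta> (i+2))\<close>.  Over an extension field one would write
  \<open>\<beta> = q + 1/q\<close>, solve the recurrence, and find for generic \<open>q\<close>
  \[ \vartheta_i = \frac{(1-q^i)(1-q^{d+1-i})}{(1-q)(1-q^d)}, \]
  while \<open>q^n \<noteq> 1\<close> for \<open>1 \<le> n \<le> d\<close> because \<open>1 - q^n\<close> divides \<open>\<theta> 0 - \<theta> n\<close>; the values
  \<open>\<beta> = \<plusminus>2\<close> would need separate solutions.

  The proof below is the same argument made uniform in \<open>\<beta>\<close> and kept inside the ground field.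
  The role of \<open>q^(n/2) - q^(-n/2)\<close> is taken by the Lehmer numbers \<open>L n\<close>
  (\<open>lehmer \<beta> n\<close>), which are polynomials in \<open>\<beta>\<close>.  The recurrence gives \<open>\<theta> a - \<theta> b = L (b-a) * c (a+b)\<close> for \<open>a \<le> b\<close>, with a factor
  \<open>c\<close> that sees only \<open>a + b\<close> (lemma \<open>diff_eq_signed_lehmer\<close>).  Hence distinctness forces
  \<open>L n \<noteq> 0\<close> for \<open>1 \<le> n \<le> d\<close>.  All numerators in \<open>\<vartheta>\<close> have index sum \<open>d\<close>, so they share the factor
  \<open>c d\<close>, and the remaining sum of Lehmer numbers telescopes to
  \<open>L i * L (d+1-i)\<close>, times an extra factor \<open>\<beta>+2\<close> if both indices are even
  (lemma \<open>sum_signed_lehmer\<close>).  Both indices can be even only if \<open>d\<close> is odd, so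
  the product vanishes nowhere as soon as \<open>\<beta> \<noteq> -2\<close> or \<open>d\<close> is even, and each of the
  three alternatives of the theorem implies this.
\<close>

section \<open>Lehmer numbers\<close>

text \<open>For \<open>\<beta> = q + 1/q\<close> and \<open>[n] = q^(n/2) - q^(-n/2)\<close> this is \<open>[n]/[1]\<close> if \<open>n\<close> is odd and
  \<open>[n]/[2]\<close> if \<open>n\<close> is even; the different denominators remove the half-integer powers, at
  the price of \<open>([2]/[1])^2 = \<beta> + 2\<close> in the recursion.\<close>

fun lehmer :: "'a::comm_ring_1 \<Rightarrow> nat \<Rightarrow> 'a" where
  "lehmer \<beta> 0 = 0"
| "lehmer \<beta> (Suc 0) = 1"
| "lehmer \<beta> (Suc (Suc n)) =
     (if even n then 1 else \<beta> + 2) * lehmer \<beta> (Suc n) - lehmer \<beta> n"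

lemma lehmer_2 [simp]: "lehmer \<beta> 2 = 1"
  by (simp add: numeral_2_eq_2)

lemma lehmer_3 [simp]: "lehmer \<beta> 3 = \<beta> + 1"
  by (simp add: numeral_3_eq_3)

lemma lehmer_add_4: "lehmer \<beta> (n + 4) = \<beta> * lehmer \<beta> (n + 2) - lehmer \<beta> n"
proof -
  have "n + 4 = Suc (Suc (Suc (Suc n)))" "n + 2 = Suc (Suc n)"
    by simp_all
  then show ?thesis
    by (simp only:) (simp add: algebra_simps)
qed

definition signed_lehmer :: "'a::comm_ring_1 \<Rightarrow> nat \<Rightarrow> nat \<Rightarrow> 'a" where
  "signed_lehmer \<beta> i j = (if i \<le> j then lehmer \<beta> (j - i) else - lehmer \<beta> (i - j))"

text \<open>In terms of \<open>[n]\<close> this is \<open>[m] [n] / ([1] [r])\<close>, where \<open>r\<close> is \<open>1\<close> if \<open>m + n\<close> is even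
  and \<open>2\<close> otherwise; hence the correction when both arguments are even.\<close>

definition lehmer_prod :: "'a::comm_ring_1 \<Rightarrow> nat \<Rightarrow> nat \<Rightarrow> 'a" where
  "lehmer_prod \<beta> m n = (if even m \<and> even n then \<beta> + 2 else 1) * lehmer \<beta> m * lehmer \<beta> n"

text \<open>The product-to-sum formula \<open>[i+1] [j] - [i] [j+1] = [1] [j-i]\<close>.  Its left-hand side
  does not change when \<open>i\<close> and \<open>j\<close> are both increased by one, which reduces it to the cases
  \<open>i = 0\<close> and \<open>j = 0\<close>.\<close>

lemma lehmer_prod_diff:
  "lehmer_prod \<beta> (Suc i) j - lehmer_prod \<beta> i (Suc j) = signed_lehmer \<beta> i j"
proof (induction i arbitrary: j)
  case 0
  then show ?case by (simp add: lehmer_prod_def signed_lehmer_def)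
next
  case (Suc i)
  show ?case
  proof (cases j)
    case 0
    then show ?thesis by (simp add: lehmer_prod_def signed_lehmer_def)
  next
    case (Suc k)
    have "lehmer_prod \<beta> (Suc (Suc i)) (Suc k) - lehmer_prod \<beta> (Suc i) (Suc (Suc k))
        = lehmer_prod \<beta> (Suc i) k - lehmer_prod \<beta> i (Suc k)"
      by (simp add: lehmer_prod_def algebra_simps)
    also have "\<dots> = signed_lehmer \<beta> i k"
      by (rule Suc.IH)
    also have "\<dots> = signed_lehmer \<beta> (Suc i) (Suc k)"
      by (simp add: signed_lehmer_def)
    finally show ?thesis using Suc by simp
  qed
qed

lemma sum_signed_lehmer:
  assumes "i \<le> Suc d"
  shows "(\<Sum>h<i. signed_lehmer \<beta> h (d - h)) = lehmer_prod \<beta> i (Suc d - i)"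
  using assms
proof (induction i)
  case 0
  then show ?case by (simp add: lehmer_prod_def)
next
  case (Suc i)
  then show ?case
    using lehmer_prod_diff[of \<beta> i "d - i"] by (simp add: Suc_diff_le algebra_simps)
qed

section \<open>Sequences satisfying the eigenvalue recurrence\<close>

definition beta_recurrent :: "nat \<Rightarrow> 'a::comm_ring_1 \<Rightarrow> (nat \<Rightarrow> 'a) \<Rightarrow> bool" where
  "beta_recurrent d \<beta> \<theta> \<longleftrightarrow>
     (\<forall>i. i + 3 \<le> d \<longrightarrow> \<theta> i - \<theta> (i + 3) = (\<beta> + 1) * (\<theta> (i + 1) - \<theta> (i + 2)))"

text \<open>The recurrence says that \<open>\<theta> i - \<beta> \<theta> (i+1) + \<theta> (i+2)\<close> takes the same value at
  neighbouring indices.\<close>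

lemma beta_recurrent_second_difference:
  assumes "beta_recurrent d \<beta> \<theta>" and "i + 2 \<le> d"
  shows "\<theta> i - \<beta> * \<theta> (i + 1) + \<theta> (i + 2) = \<theta> 0 - \<beta> * \<theta> 1 + \<theta> 2"
  using assms(2)
proof (induction i)
  case 0
  then show ?case by (simp add: numeral_2_eq_2)
next
  case (Suc i)
  have "\<theta> i - \<theta> (i + 3) = (\<beta> + 1) * (\<theta> (i + 1) - \<theta> (i + 2))"
    using assms(1) Suc.prems by (simp add: beta_recurrent_def)
  then have "\<theta> (Suc i) - \<beta> * \<theta> (Suc i + 1) + \<theta> (Suc i + 2) = \<theta> i - \<beta> * \<theta> (i + 1) + \<theta> (i + 2)"
    by (simp add: numeral_eq_Suc algebra_simps)
  then show ?case using Suc by simp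
qed

text \<open>The innermost difference \<open>\<theta> a - \<theta> b\<close> with \<open>a < b\<close> and \<open>a + b = s\<close>: here \<open>b - a\<close> is \<open>1\<close> or
  \<open>2\<close>, and \<open>L 1 = L 2 = 1\<close>.  For \<open>s = 0\<close> there is no such pair, but then \<open>a = b = 0\<close> and the
  value is multiplied by \<open>L 0 = 0\<close>.\<close>

definition central_diff :: "(nat \<Rightarrow> 'a::ab_group_add) \<Rightarrow> nat \<Rightarrow> 'a" where
  "central_diff \<theta> s =
     (if even s then \<theta> (s div 2 - 1) - \<theta> (s div 2 + 1) else \<theta> (s div 2) - \<theta> (s div 2 + 1))"

text \<open>For a fixed index sum, both sides satisfy the recurrence of \<open>lehmer_add_4\<close> as the gap
  \<open>n\<close> grows in steps of two: for the left-hand side, compare the constant of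
  \<open>beta_recurrent_second_difference\<close> at the two ends.\<close>

lemma diff_eq_lehmer:
  assumes rec: "beta_recurrent d \<beta> \<theta>"
  shows "a + n \<le> d \<Longrightarrow> \<theta> a - \<theta> (a + n) = lehmer \<beta> n * central_diff \<theta> (2 * a + n)"
proof (induction n arbitrary: a rule: less_induct)
  case (less n)
  consider "n = 0" | "n = 1" | "n = 2" | "n = 3" | m where "n = m + 4"
  proof (cases "n < 4")
    case False
    then have "n = n - 4 + 4" by simp
    then show ?thesis by (rule that(5))
  qed (use that in force)
  then show ?case
  proof cases
    case 4
    then have "central_diff \<theta> (2 * a + n) = \<theta> (a + 1) - \<theta> (a + 2)"
      by (simp add: central_diff_def)
    then show ?thesis
      using rec less.prems 4 by (simp add: beta_recurrent_def)
  next
    case (5 m)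
    have outer: "\<theta> a - \<beta> * \<theta> (a + 1) + \<theta> (a + 2)
        = \<theta> (a + m + 2) - \<beta> * \<theta> (a + m + 3) + \<theta> (a + m + 4)"
      using beta_recurrent_second_difference[OF rec, of a]
        beta_recurrent_second_difference[OF rec, of "a + m + 2"] less.prems 5
      by (simp add: numeral_eq_Suc)
    have inner1: "\<theta> (a + 1) - \<theta> (a + m + 3) = lehmer \<beta> (m + 2) * central_diff \<theta> (2 * a + n)"
      using less.IH[of "m + 2" "a + 1"] less.prems 5
      by (simp add: numeral_eq_Suc)
    have inner2: "\<theta> (a + 2) - \<theta> (a + m + 2) = lehmer \<beta> m * central_diff \<theta> (2 * a + n)"
      using less.IH[of m "a + 2"] less.prems 5
      by (simp add: numeral_eq_Suc)
    have "\<theta> a - \<theta> (a + n)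
        = \<beta> * (\<theta> (a + 1) - \<theta> (a + m + 3)) - (\<theta> (a + 2) - \<theta> (a + m + 2))"
      using outer 5 by (simp add: algebra_simps)
    also have "\<dots> = lehmer \<beta> n * central_diff \<theta> (2 * a + n)"
      unfolding inner1 inner2 5 lehmer_add_4 by (simp add: algebra_simps)
    finally show ?thesis .
  qed (simp_all add: central_diff_def)
qed

lemma diff_eq_signed_lehmer:
  assumes "beta_recurrent d \<beta> \<theta>" and "i \<le> d" and "j \<le> d"
  shows "\<theta> i - \<theta> j = signed_lehmer \<beta> i j * central_diff \<theta> (i + j)"
proof (cases "i \<le> j")
  case True
  then show ?thesis
    using diff_eq_lehmer[OF assms(1), of i "j - i"] assms
    by (simp add: signed_lehmer_def mult_2)
next
  case False
  then have "\<theta> j - \<theta> i = lehmer \<beta> (i - j) * central_diff \<theta> (i + j)"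
    using diff_eq_lehmer[OF assms(1), of j "i - j"] assms
    by (simp add: mult_2 add.commute)
  then show ?thesis
    using False by (simp add: signed_lehmer_def algebra_simps)
qed

lemma lehmer_nonzero:
  assumes "beta_recurrent d \<beta> \<theta>" and "inj_on \<theta> {0..d}" and "1 \<le> n" and "n \<le> d"
  shows "lehmer \<beta> n \<noteq> 0"
proof
  assume "lehmer \<beta> n = 0"
  then have "\<theta> 0 = \<theta> n"
    using diff_eq_lehmer[OF assms(1), of 0 n] assms(4) by simp
  then show False
    using assms(2-4) by (auto dest: inj_onD)
qed

lemma vartheta_eq:
  assumes "beta_recurrent d \<beta> \<theta>" and "i \<le> Suc d"
  shows "vartheta d \<theta> i = lehmer_prod \<beta> i (Suc d - i) * central_diff \<theta> d / (\<theta> 0 - \<theta> d)"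
proof -
  have "vartheta d \<theta> i = (\<Sum>h<i. \<theta> h - \<theta> (d - h)) / (\<theta> 0 - \<theta> d)"
    by (simp add: vartheta_def sum_divide_distrib)
  \<comment> \<open>\<open>h + (d - h) = d\<close> for every \<open>h\<close>, so all terms share one central difference.\<close>
  also have "(\<Sum>h<i. \<theta> h - \<theta> (d - h)) = (\<Sum>h<i. signed_lehmer \<beta> h (d - h) * central_diff \<theta> d)"
    using assms by (intro sum.cong) (simp_all add: diff_eq_signed_lehmer)
  also have "\<dots> = lehmer_prod \<beta> i (Suc d - i) * central_diff \<theta> d"
    using assms(2) by (simp add: sum_signed_lehmer flip: sum_distrib_right)
  finally show ?thesis .
qed

lemma vartheta_nonzero:
  fixes \<theta> :: "nat \<Rightarrow> 'a::field"
  assumes rec: "beta_recurrent d \<beta> \<theta>" and inj: "inj_on \<theta> {0..d}"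
    and \<beta>: "\<beta> \<noteq> - 2 \<or> even d" and i: "1 \<le> i" "i \<le> d"
  shows "vartheta d \<theta> i \<noteq> 0"
proof -
  have "\<theta> 0 \<noteq> \<theta> d"
    using inj i by (auto dest: inj_onD)
  then have "central_diff \<theta> d \<noteq> 0"
    using diff_eq_lehmer[OF rec, of 0 d] by auto
  moreover have "lehmer \<beta> i \<noteq> 0" "lehmer \<beta> (Suc d - i) \<noteq> 0"
    using lehmer_nonzero[OF rec inj] i by simp_all
  \<comment> \<open>If \<open>i\<close> and \<open>d + 1 - i\<close> are both even, then \<open>d\<close> is odd.\<close>
  moreover have "\<beta> + 2 \<noteq> 0" if "even i" "even (Suc d - i)"
    using \<beta> that i by (auto simp: eq_neg_iff_add_eq_0)
  ultimately show ?thesis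
    using vartheta_eq[OF rec, of i] i \<open>\<theta> 0 \<noteq> \<theta> d\<close> by (auto simp: lehmer_prod_def)
qed

section \<open>Eigenvalues of tridiagonal systems\<close>

text \<open>Each listed eigenspace is nonzero, so a scalar by which \<open>A\<close> acts on it determines it; the
  list has no repetitions.\<close>

lemma (in td_space) inj_on_eigenvalues:
  assumes sys: "td_system d A E As Es" and ev: "eigenvalue_sequence d A E \<theta>"
  shows "inj_on \<theta> {0..d}"
proof -
  define U where "U i = range (E i)" for i
  have bij: "bij_betw U {0..d} (eigenspaces A)"
    using sys by (simp add: td_system_def standard_ordering_def U_def[abs_def])
  have U_eq: "U i = eigenspace A (\<theta> i)" if i: "i \<in> {0..d}" for i
  proof -
    have "U i \<in> eigenspaces A"
      using bij i by (rule bij_betwE[rule_format])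
    then obtain t where t: "U i = eigenspace A t" "eigenspace A t \<noteq> {0}"
      by (auto simp: eigenspaces_def)
    moreover have "U i \<noteq> {}"
      by (simp add: U_def)
    ultimately obtain v where v: "v \<in> U i" "v \<noteq> 0"
      by blast
    have "A v = scale t v"
      using v(1) t(1) by (simp add: eigenspace_def)
    moreover have "A v = scale (\<theta> i) v"
      using ev i v(1) unfolding eigenvalue_sequence_def U_def by blast
    ultimately have "scale t v = scale (\<theta> i) v"
      by metis
    then have "t = \<theta> i"
      using v(2) by auto
    then show ?thesis using t(1) by simp
  qed
  show ?thesis
  proof (rule inj_onI)
    fix i j assume ij: "i \<in> {0..d}" "j \<in> {0..d}" "\<theta> i = \<theta> j"
    then have "U i = U j"
      by (simp only: U_eq)
    then show "i = j"
      using bij_betw_imp_inj_on[OF bij] ij(1,2) by (simp add: inj_on_eq_iff)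
  qed
qed

lemma is_base_imp_beta_recurrent:
  assumes base: "is_base d \<theta> \<theta>s \<beta>" and inj: "inj_on \<theta> {0..d}"
  shows "beta_recurrent d \<beta> \<theta>"
  unfolding beta_recurrent_def
proof (intro allI impI)
  fix i assume i: "i + 3 \<le> d"
  then have "(\<theta> (i + 2 - 2) - \<theta> (i + 2 + 1)) / (\<theta> (i + 2 - 1) - \<theta> (i + 2)) = \<beta> + 1"
    using base unfolding is_base_def
    by (auto dest!: bspec[where x = "i + 2"])
  moreover have "\<theta> (i + 1) \<noteq> \<theta> (i + 2)"
    using inj i by (auto dest: inj_onD)
  ultimately show "\<theta> i - \<theta> (i + 3) = (\<beta> + 1) * (\<theta> (i + 1) - \<theta> (i + 2))"
    by (simp add: field_simps numeral_eq_Suc)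
qed

text \<open>Separates the case \<open>\<beta> = 2\<close> from the exceptional value \<open>\<beta> = -2\<close>.\<close>

lemma two_neq_minus_two_if_CHAR:
  assumes "CHAR('a::field) \<noteq> 2"
  shows "(2 :: 'a) \<noteq> - 2"
proof
  assume "(2 :: 'a) = - 2"
  then have "(2 :: 'a) * 2 = 0"
    by (simp add: eq_neg_iff_add_eq_0)
  then have "of_nat 2 = (0 :: 'a)"
    unfolding mult_eq_0_iff by simp
  then have "CHAR('a) dvd 2"
    by (simp only: of_nat_eq_0_iff_char_dvd)
  then have "CHAR('a) = 1"
    using assms two_is_prime_nat by (auto simp: prime_nat_iff)
  then show False
    by simp
qed

theorem corollary13p3:
  fixes scale :: "'k::field \<Rightarrow> 'v::ab_group_add \<Rightarrow> 'v"
    and Basis :: "'v set"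
    and A As :: "'v \<Rightarrow> 'v"
    and E Es :: "nat \<Rightarrow> 'v \<Rightarrow> 'v"
    and \<theta> \<theta>s :: "nat \<Rightarrow> 'k"
    and \<beta> :: 'k
    and d :: nat
  assumes "td_space scale Basis"
    and "td_space.td_system scale d A E As Es"
    and "d \<ge> 1"
    and "td_space.eigenvalue_sequence scale d A E \<theta>"
    and "td_space.eigenvalue_sequence scale d As Es \<theta>s"
    and "is_base d \<theta> \<theta>s \<beta>"
    and "(\<beta> \<noteq> 2 \<and> \<beta> \<noteq> -2) \<or>
         (\<beta> = 2 \<and> CHAR('k) \<noteq> 2) \<or>
         (\<beta> = -2 \<and> CHAR('k) \<noteq> 2 \<and> even d)"
  shows "\<forall>i\<in>{1..d}. vartheta d \<theta> i \<noteq> 0"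
proof -
  interpret td_space scale Basis by fact
  have inj: "inj_on \<theta> {0..d}"
    using assms(2,4) by (rule inj_on_eigenvalues)
  have rec: "beta_recurrent d \<beta> \<theta>"
    using assms(6) inj by (rule is_base_imp_beta_recurrent)
  have "\<beta> \<noteq> - 2 \<or> even d"
    using assms(7) two_neq_minus_two_if_CHAR by metis
  then show ?thesis
    using vartheta_nonzero[OF rec inj] by simp
qed

end
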